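(* Let $\Sigma$ be a polyhedral fan in $\mathbb{R}^d$ and let $\mathcal{F}(\Sigma)$ be its face poset, i.e. the set of closed cones in $\Sigma$ ordered by inclusion, with the zero cone $\{0\}$ as minimal element. For every cone $\tau\in\Sigma$, $\tau\ne\{0\}$, the face poset of the stellar subdivision $\mathrm{sd}(\Sigma,\tau)$ of $\Sigma$ in $\tau$ is (isomorphic to) the combinatorial blowup of $\mathcal{F}(\Sigma)$ at $\tau$: $$\mathcal{F}(\mathrm{sd}(\Sigma,\tau))=\mathrm{Bl}_\tau\mathcal{F}(\Sigma).$$
   Context: A polyhedral fan is a finite collection of closed pointed polyhedral cones in $\mathbb{R}^d$, closed under taking faces and such that the intersection of any two cones is a common face of both (hence a cone of the fan). Stellar subdivision: for $\tau\in\Sigma$, $\tau\neq\{0\}$, and $x\in\mathrm{relint}\,\tau$, let $\mathrm{star}(\tau,\Sigma)=\{\sigma\in\Sigma\mid\tau\subseteq\sigma\}$. The stellar subdivision $\mathrm{sd}(\Sigma,x)$ is the collection of cones $$(\Sigma\setminus\mathrm{star}(\tau,\Sigma))\cup\{\mathrm{cone}(x,\rho)\mid\rho\in\Sigma\setminus\mathrm{star}(\tau,\Sigma),\ \rho\subseteq\sigma\text{ for some }\sigma\in\mathrm{star}(\tau,\Sigma)\},$$ where $\mathrm{cone}(x,\rho)$ is the closed polyhedral cone spanned by $\rho$ and $x$. $\mathrm{sd}(\Sigma,\tau)$ denotes any $\mathrm{sd}(\Sigma,x)$ with $x\in\mathrm{relint}\,\tau$. Combinatorial blowup: for a finite meet-semilattice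 $\mathcal{L}$ and $\alpha\in\mathcal{L}$, the poset $\mathrm{Bl}_\alpha\mathcal{L}$ has as elements (1) the $y\in\mathcal{L}$ with $y\not\ge\alpha$, and (2) formal symbols $[\alpha,y]$ for $y\in\mathcal{L}$ such that $y\not\ge\alpha$ and the join $y\vee\alpha$ exists in $\mathcal{L}$. Its strict order relations are, for $y,z\not\ge\alpha$: $y>z$ if $y>z$ in $\mathcal{L}$; $[\alpha,y]>[\alpha,z]$ if $y>z$ in $\mathcal{L}$; $[\alpha,y]>z$ if $y\ge z$ in $\mathcal{L}$. *)

theory Defs
  imports "HOL-Algebra.Lattice" "HOL-Analysis.Analysis"
begin

section \<open>Polyhedral fans and stellar subdivisions\<close>

definition pointed_polyhedral_cone :: "'a::euclidean_space set \<Rightarrow> bool"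
  where "pointed_polyhedral_cone \<sigma> \<longleftrightarrow>
    polyhedron \<sigma> \<and> convex_cone \<sigma> \<and> \<sigma> \<inter> uminus ` \<sigma> = {0}"

text \<open>The library relation \<open>face_of\<close> counts the empty set as a face of every convex set; a face of
  a cone is always nonempty.  The intersection of two cones contains \<open>0\<close>, so no such proviso is
  needed in the last clause.\<close>

definition polyhedral_fan :: "'a::euclidean_space set set \<Rightarrow> bool"
  where "polyhedral_fan \<Sigma> \<longleftrightarrow>
    finite \<Sigma> \<and>
    (\<forall>\<sigma>\<in>\<Sigma>. pointed_polyhedral_cone \<sigma>) \<and>
    (\<forall>\<sigma>\<in>\<Sigma>. \<forall>\<rho>. \<rho> face_of \<sigma> \<and> \<rho> \<noteq> {} \<longrightarrow> \<rho> \<in> \<Sigma>) \<and>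
    (\<forall>\<sigma>\<in>\<Sigma>. \<forall>\<sigma>'\<in>\<Sigma>. \<sigma> \<inter> \<sigma>' face_of \<sigma> \<and> \<sigma> \<inter> \<sigma>' face_of \<sigma>')"

definition fan_star :: "'a set \<Rightarrow> 'a set set \<Rightarrow> 'a set set"
  where "fan_star \<tau> \<Sigma> = {\<sigma> \<in> \<Sigma>. \<tau> \<subseteq> \<sigma>}"

text \<open>\<open>stellar_subdivision \<Sigma> \<tau> x\<close> is \<open>sd(\<Sigma>, x)\<close>; it is meant for \<open>x \<in> rel_interior \<tau>\<close>, in which case \<open>\<tau>\<close>
  is determined by \<open>x\<close>.  The cone spanned by \<open>\<rho>\<close> and \<open>x\<close> needs no topological closure, as the convex
  cone generated by a polyhedral cone and a further vector is closed.\<close>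

definition stellar_subdivision :: "'a::euclidean_space set set \<Rightarrow> 'a set \<Rightarrow> 'a \<Rightarrow> 'a set set"
  where "stellar_subdivision \<Sigma> \<tau> x =
    (\<Sigma> - fan_star \<tau> \<Sigma>) \<union>
    {convex_cone hull (insert x \<rho>) |\<rho>.
       \<rho> \<in> \<Sigma> - fan_star \<tau> \<Sigma> \<and> (\<exists>\<sigma>\<in>fan_star \<tau> \<Sigma>. \<rho> \<subseteq> \<sigma>)}"


section \<open>Posets and combinatorial blowups\<close>

definition face_poset :: "'a set set \<Rightarrow> 'a set gorder"
  where "face_poset \<Sigma> = \<lparr>carrier = \<Sigma>, eq = (=), le = (\<subseteq>)\<rparr>"

definition order_isomorphic :: "('a, 'c) gorder_scheme \<Rightarrow> ('b, 'd) gorder_scheme \<Rightarrow> bool"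
  where "order_isomorphic P Q \<longleftrightarrow>
    (\<exists>f. order_emb P Q f \<and> bij_betw f (carrier P) (carrier Q))"

text \<open>\<open>Symb \<alpha> y\<close> is the formal symbol \<open>[\<alpha>, y]\<close>.\<close>

datatype 'a blowup_elem = Elem 'a | Symb 'a 'a

text \<open>\<open>blowup_less L u v\<close> means \<open>u < v\<close>.  In the blowup at \<open>\<alpha>\<close> all symbols have first component
  \<open>\<alpha>\<close>, which therefore plays no role in the order.\<close>

fun blowup_less :: "('a, 'c) gorder_scheme \<Rightarrow> 'a blowup_elem \<Rightarrow> 'a blowup_elem \<Rightarrow> bool"
  where
    "blowup_less L (Elem z) (Elem y) \<longleftrightarrow> z \<sqsubset>\<^bsub>L\<^esub> y"
  | "blowup_less L (Symb _ z) (Symb _ y) \<longleftrightarrow> z \<sqsubset>\<^bsub>L\<^esub> y"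
  | "blowup_less L (Elem z) (Symb _ y) \<longleftrightarrow> z \<sqsubseteq>\<^bsub>L\<^esub> y"
  | "blowup_less L (Symb _ z) (Elem y) \<longleftrightarrow> False"

definition blowup :: "'a \<Rightarrow> ('a, 'c) gorder_scheme \<Rightarrow> 'a blowup_elem gorder"
  where "blowup \<alpha> L =
    \<lparr>carrier =
       {Elem y |y. y \<in> carrier L \<and> \<not> \<alpha> \<sqsubseteq>\<^bsub>L\<^esub> y} \<union>
       {Symb \<alpha> y |y. y \<in> carrier L \<and> \<not> \<alpha> \<sqsubseteq>\<^bsub>L\<^esub> y \<and> (\<exists>j. least L j (Upper L {y, \<alpha>}))},
     eq = (=),
     le = (\<lambda>u v. blowup_less L u v \<or> u = v)\<rparr>"

text \<open>Face posets of fans, to which the blowup is applied, are finite meet-semilattices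
  with least element \<open>{0}\<close>.\<close>

lemma face_poset_partial_order: "partial_order (face_poset \<Sigma>)"
  by unfold_locales (auto simp: face_poset_def)

lemma polyhedral_fan_Int:
  assumes "polyhedral_fan \<Sigma>" "\<sigma> \<in> \<Sigma>" "\<sigma>' \<in> \<Sigma>"
  shows "\<sigma> \<inter> \<sigma>' \<in> \<Sigma>"
proof -
  have "\<sigma> \<inter> \<sigma>' face_of \<sigma>" "0 \<in> \<sigma>" "0 \<in> \<sigma>'"
    using assms by (auto simp: polyhedral_fan_def pointed_polyhedral_cone_def convex_cone_contains_0)
  then show ?thesis
    using assms unfolding polyhedral_fan_def by blast
qed

lemma face_poset_finite_meet_semilattice:
  assumes "polyhedral_fan \<Sigma>"
  shows "finite (carrier (face_poset \<Sigma>))" and "lower_semilattice (face_poset \<Sigma>)"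
proof -
  show "finite (carrier (face_poset \<Sigma>))"
    using assms by (simp add: face_poset_def polyhedral_fan_def)
  have "greatest (face_poset \<Sigma>) (\<sigma> \<inter> \<sigma>') (Lower (face_poset \<Sigma>) {\<sigma>, \<sigma>'})"
    if "\<sigma> \<in> \<Sigma>" "\<sigma>' \<in> \<Sigma>" for \<sigma> \<sigma>'
    using polyhedral_fan_Int[OF assms that] that
    by (auto simp: face_poset_def greatest_def Lower_def)
  then show "lower_semilattice (face_poset \<Sigma>)"
    by (intro lower_semilattice.intro face_poset_partial_order lower_semilattice_axioms.intro)
       (auto simp: face_poset_def)
qed

lemma face_poset_least_zero:
  assumes "polyhedral_fan \<Sigma>" "\<Sigma> \<noteq> {}"
  shows "least (face_poset \<Sigma>) {0} (carrier (face_poset \<Sigma>))"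
proof -
  have cone: "pointed_polyhedral_cone \<sigma>" if "\<sigma> \<in> \<Sigma>" for \<sigma>
    using assms that by (simp add: polyhedral_fan_def)
  then have zero: "0 \<in> \<sigma>" if "\<sigma> \<in> \<Sigma>" for \<sigma>
    using that by (simp add: pointed_polyhedral_cone_def convex_cone_contains_0)
  obtain \<sigma> where \<sigma>: "\<sigma> \<in> \<Sigma>"
    using assms by blast
  have "{0} face_of \<sigma>"
  proof (subst face_of_singleton, subst extreme_point_of_def, intro conjI ballI notI)
    show "0 \<in> \<sigma>" by (rule zero[OF \<sigma>])
  next
    fix a b assume ab: "a \<in> \<sigma>" "b \<in> \<sigma>" "0 \<in> open_segment a b"
    then obtain u where u: "a \<noteq> b" "0 < u" "u < 1" "0 = (1 - u) *\<^sub>R a + u *\<^sub>R b"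
      by (auto simp: in_segment)
    have cc: "convex_cone \<sigma>" and pt: "\<sigma> \<inter> uminus ` \<sigma> = {0}"
      using cone[OF \<sigma>] by (auto simp: pointed_polyhedral_cone_def)
    have *: "(1 - u) *\<^sub>R a = - (u *\<^sub>R b)"
      using u(4) by (simp add: eq_neg_iff_add_eq_0)
    have "(1 - u) *\<^sub>R a \<in> \<sigma>" "u *\<^sub>R b \<in> \<sigma>"
      using ab u cc by (auto intro: convex_cone_scaleR)
    then have "(1 - u) *\<^sub>R a \<in> \<sigma> \<inter> uminus ` \<sigma>"
      using * by auto
    then have "(1 - u) *\<^sub>R a = 0" "u *\<^sub>R b = 0"
      using pt * by auto
    then show False
      using u by auto
  qed
  then have "{0} \<in> \<Sigma>"
    using assms \<sigma> unfolding polyhedral_fan_def by blast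
  then show ?thesis
    using zero by (auto simp: face_poset_def least_def)
qed

end

(* A cone of the fan contains x iff it contains \<tau>, because \<tau> \<inter> \<sigma> is a face of \<tau> and x lies in the
   relative interior of \<tau>. If \<rho> and z avoid x, \<rho> lies in a cone \<sigma> containing \<tau>, and
   r + t x \<in> z with r \<in> \<rho>, then t = 0: otherwise x would lie in the face z \<inter> \<sigma> of \<sigma>. So
   z \<subseteq> cone(x, \<rho>) is equivalent to z \<subseteq> \<rho>, and this says that y \<mapsto> y, [\<tau>, y] \<mapsto> cone(x, y) respects and
   reflects the order. *)

theory Submission
  imports Defs
begin

section \<open>Order isomorphisms and the order of a blowup\<close>

lemma order_emb_inj_on:
  assumes "order_emb P Q f" "partial_order P" "partial_order Q"
  shows "inj_on f (carrier P)"
proof (rule inj_onI)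
  interpret P: partial_order P by fact
  interpret Q: partial_order Q by fact
  fix a b assume ab: "a \<in> carrier P" "b \<in> carrier P" "f a = f b"
  have emb: "f a \<sqsubseteq>\<^bsub>Q\<^esub> f b \<longleftrightarrow> a \<sqsubseteq>\<^bsub>P\<^esub> b" if "a \<in> carrier P" "b \<in> carrier P" for a b
    using assms(1) that by (simp add: order_emb_def)
  have "a \<sqsubseteq>\<^bsub>P\<^esub> b" "b \<sqsubseteq>\<^bsub>P\<^esub> a"
    using emb[of a b] emb[of b a] emb[of a a] ab by auto
  then show "a = b"
    using ab P.le_antisym by auto
qed

text \<open>The explicit map runs from the blowup to the subdivision, since a symbol determines its
  cone directly, whereas the theorem is stated in the opposite direction.\<close>

lemma order_isomorphic_sym:
  assumes "order_isomorphic P Q"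
  shows "order_isomorphic Q P"
proof -
  obtain f where f: "order_emb P Q f" "bij_betw f (carrier P) (carrier Q)"
    using assms by (auto simp: order_isomorphic_def)
  let ?g = "inv_into (carrier P) f"
  have g: "bij_betw ?g (carrier Q) (carrier P)"
    using f(2) by (rule bij_betw_inv_into)
  moreover have "order_emb Q P ?g"
    unfolding order_emb_def
  proof (intro conjI ballI)
    fix u v assume "u \<in> carrier Q" "v \<in> carrier Q"
    then have "?g u \<in> carrier P" "?g v \<in> carrier P" "f (?g u) = u" "f (?g v) = v"
      using g f(2) by (auto simp: bij_betwE bij_betw_inv_into_right)
    then show "?g u \<sqsubseteq>\<^bsub>P\<^esub> ?g v \<longleftrightarrow> u \<sqsubseteq>\<^bsub>Q\<^esub> v"
      using f(1) unfolding order_emb_def by metis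
  qed (use f(1) in \<open>auto simp: order_emb_def\<close>)
  ultimately show ?thesis
    by (auto simp: order_isomorphic_def)
qed

text \<open>Adding equality to the strict relations turns each proper inclusion into an inclusion.
  For two symbols this relies on membership in the carrier: both first components are
  \<open>\<tau>\<close>, so equal second components give equal symbols.\<close>

lemma blowup_face_poset_le:
  assumes "u \<in> carrier (blowup \<tau> (face_poset \<Sigma>))" "v \<in> carrier (blowup \<tau> (face_poset \<Sigma>))"
  shows "u \<sqsubseteq>\<^bsub>blowup \<tau> (face_poset \<Sigma>)\<^esub> v \<longleftrightarrow>
    (case (u, v) of
       (Elem z, Elem y) \<Rightarrow> z \<subseteq> y
     | (Symb _ z, Symb _ y) \<Rightarrow> z \<subseteq> y
     | (Elem z, Symb _ y) \<Rightarrow> z \<subseteq> y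
     | (Symb _ z, Elem y) \<Rightarrow> False)"
  using assms by (auto simp: blowup_def face_poset_def lless_def)

lemma blowup_face_poset_partial_order: "partial_order (blowup \<tau> (face_poset \<Sigma>))"
proof -
  let ?B = "blowup \<tau> (face_poset \<Sigma>)"
  have eq: "(.=\<^bsub>?B\<^esub>) = (=)"
    by (simp add: blowup_def)
  \<comment> \<open>The order compares only second components, so antisymmetry for symbols requires
    the first components to agree.\<close>
  have fst: "a = \<tau>" if "Symb a y \<in> carrier ?B" for a y
    using that by (auto simp: blowup_def)
  note le = blowup_face_poset_le[of _ \<tau> \<Sigma>]
  show ?thesis
  proof (unfold_locales, unfold eq)
    fix u v w assume uvw: "u \<in> carrier ?B" "v \<in> carrier ?B" "w \<in> carrier ?B"
    assume "u \<sqsubseteq>\<^bsub>?B\<^esub> v" "v \<sqsubseteq>\<^bsub>?B\<^esub> w"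
    then show "u \<sqsubseteq>\<^bsub>?B\<^esub> w"
      unfolding le[OF uvw(1,2)] le[OF uvw(2,3)] le[OF uvw(1,3)]
      by (cases u; cases v; cases w) auto
  next
    fix u v assume uv: "u \<in> carrier ?B" "v \<in> carrier ?B"
    assume "u \<sqsubseteq>\<^bsub>?B\<^esub> v" "v \<sqsubseteq>\<^bsub>?B\<^esub> u"
    then show "u = v"
      unfolding le[OF uv] le[OF uv(2,1)]
      using uv by (cases u; cases v) (auto dest!: fst)
  next
    fix u assume u: "u \<in> carrier ?B"
    show "u \<sqsubseteq>\<^bsub>?B\<^esub> u"
      unfolding le[OF u u] by (cases u) auto
  qed auto
qed

section \<open>Joins and cones in a fan\<close>

text \<open>The common upper bounds form a finite set closed under intersection. A minimal one,
  \<open>m\<close>, equals \<open>m \<inter> \<sigma>\<close> for every other bound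
  \<open>\<sigma>\<close> and is therefore the least. This matches the join condition of the blowup
  with the star condition of the subdivision.\<close>

lemma polyhedral_fan_join_exists_iff:
  assumes fan: "polyhedral_fan \<Sigma>" and "\<rho> \<in> \<Sigma>" "\<tau> \<in> \<Sigma>"
  shows "(\<exists>j. least (face_poset \<Sigma>) j (Upper (face_poset \<Sigma>) {\<rho>, \<tau>})) \<longleftrightarrow>
    (\<exists>\<sigma>\<in>fan_star \<tau> \<Sigma>. \<rho> \<subseteq> \<sigma>)"
proof -
  define U where "U = {\<sigma> \<in> \<Sigma>. \<rho> \<subseteq> \<sigma> \<and> \<tau> \<subseteq> \<sigma>}"
  have U: "Upper (face_poset \<Sigma>) {\<rho>, \<tau>} = U"
    using assms by (auto simp: Upper_def face_poset_def U_def)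
  have least: "least (face_poset \<Sigma>) j U \<longleftrightarrow> j \<in> U \<and> (\<forall>\<sigma>\<in>U. j \<subseteq> \<sigma>)" for j
    by (auto simp: least_def face_poset_def U_def)
  have "\<exists>j\<in>U. \<forall>\<sigma>\<in>U. j \<subseteq> \<sigma>" if nonempty: "U \<noteq> {}"
  proof -
    have "finite U"
      using fan by (simp add: U_def polyhedral_fan_def)
    then obtain m where m: "m \<in> U" "\<And>\<sigma>. \<sigma> \<in> U \<Longrightarrow> \<sigma> \<subseteq> m \<Longrightarrow> m = \<sigma>"
      using finite_has_minimal[of U] nonempty by metis
    have "m \<inter> \<sigma> \<in> U" if "\<sigma> \<in> U" for \<sigma>
      using m(1) that polyhedral_fan_Int[OF fan] by (auto simp: U_def)
    then have "m \<subseteq> \<sigma>" if "\<sigma> \<in> U" for \<sigma>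
      using m(2)[of "m \<inter> \<sigma>"] that by blast
    then show ?thesis
      using m(1) by blast
  qed
  then show ?thesis
    unfolding U least by (auto simp: U_def fan_star_def)
qed

lemma polyhedral_fan_mem_rel_interior_iff:
  assumes "polyhedral_fan \<Sigma>" "\<tau> \<in> \<Sigma>" "\<sigma> \<in> \<Sigma>" "x \<in> rel_interior \<tau>"
  shows "x \<in> \<sigma> \<longleftrightarrow> \<tau> \<subseteq> \<sigma>"
proof
  have x: "x \<in> \<tau>"
    using assms(4) rel_interior_subset by blast
  then show "x \<in> \<sigma>" if "\<tau> \<subseteq> \<sigma>"
    using that by blast
  assume "x \<in> \<sigma>"
  moreover have "\<tau> \<inter> \<sigma> face_of \<tau>"
    using assms by (auto simp: polyhedral_fan_def)
  ultimately have "\<tau> \<subseteq> \<tau> \<inter> \<sigma>"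
    using subset_of_face_of[of "\<tau> \<inter> \<sigma>" \<tau> \<tau>] x assms(4) by blast
  then show "\<tau> \<subseteq> \<sigma>"
    by blast
qed

text \<open>The midpoint of \<open>a\<close> and \<open>b\<close> is a positive multiple of
  \<open>a + b\<close>, hence lies in \<open>F\<close>, and a face containing an interior point of a
  segment contains its ends. If \<open>a = b\<close> the open segment is empty, but then the
  midpoint is \<open>b\<close> itself.\<close>

lemma convex_cone_face_of_summand:
  assumes F: "F face_of \<sigma>" "convex_cone F" and "convex_cone \<sigma>"
    and "a \<in> \<sigma>" "b \<in> \<sigma>" "a + b \<in> F"
  shows "b \<in> F"
proof (cases "a = b")
  case True
  then have "(1/2) *\<^sub>R (a + b) \<in> F"
    using assms by (intro convex_cone_scaleR) auto
  then show ?thesis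
    using True by (simp add: scaleR_2[symmetric])
next
  case False
  have mid: "(1/2) *\<^sub>R (a + b) \<in> open_segment a b"
    using False midpoint_in_open_segment[of a b] by (simp add: midpoint_def)
  have "(1/2) *\<^sub>R (a + b) \<in> F"
    using assms by (intro convex_cone_scaleR) auto
  with mid show ?thesis
    using F(1) assms by (auto simp: face_of_def)
qed

text \<open>The right-hand side is itself a convex cone containing \<open>x\<close> and
  \<open>\<rho>\<close>. It supplies the decomposition \<open>r + t x\<close> of a point in the
  spanned cone.\<close>

lemma convex_cone_hull_insert_subset:
  assumes "convex_cone \<rho>"
  shows "convex_cone hull (insert x \<rho>) \<subseteq> {r + t *\<^sub>R x |r t. r \<in> \<rho> \<and> 0 \<le> t}" (is "_ \<subseteq> ?C")
proof (rule hull_minimal)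
  show "insert x \<rho> \<subseteq> ?C"
  proof
    fix v assume "v \<in> insert x \<rho>"
    then consider "v = 0 + 1 *\<^sub>R x" | "v \<in> \<rho>" "v = v + 0 *\<^sub>R x"
      by fastforce
    then show "v \<in> ?C"
    proof cases
      case 1
      then show ?thesis
        using convex_cone_contains_0[OF assms] zero_le_one by blast
    next
      case 2
      then show ?thesis
        using order_refl by blast
    qed
  qed
  show "convex_cone ?C"
    unfolding convex_cone_iff
  proof (intro conjI ballI allI impI)
    show "0 \<in> ?C"
      using convex_cone_contains_0[OF assms] by force
  next
    fix v w assume "v \<in> ?C" "w \<in> ?C"
    then obtain r t s u where "r \<in> \<rho>" "0 \<le> t" "v = r + t *\<^sub>R x" "s \<in> \<rho>" "0 \<le> u" "w = s + u *\<^sub>R x"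
      by blast
    then have "v + w = (r + s) + (t + u) *\<^sub>R x" "r + s \<in> \<rho>" "0 \<le> t + u"
      using convex_cone_add[OF assms] by (auto simp: algebra_simps)
    then show "v + w \<in> ?C"
      by blast
  next
    fix v and c :: real assume "v \<in> ?C" "0 \<le> c"
    then obtain r t where "r \<in> \<rho>" "0 \<le> t" "v = r + t *\<^sub>R x"
      by blast
    then have "c *\<^sub>R v = c *\<^sub>R r + (c * t) *\<^sub>R x" "c *\<^sub>R r \<in> \<rho>" "0 \<le> c * t"
      using convex_cone_scaleR[OF assms] \<open>0 \<le> c\<close> by (auto simp: algebra_simps)
    then show "c *\<^sub>R v \<in> ?C"
      by blast
  qed
qed

lemma subset_convex_cone_hull_insert_iff:
  assumes fan: "polyhedral_fan \<Sigma>" and mem: "\<sigma> \<in> \<Sigma>" "\<rho> \<in> \<Sigma>" "z \<in> \<Sigma>"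
    and "\<rho> \<subseteq> \<sigma>" "x \<in> \<sigma>" "x \<notin> z"
  shows "z \<subseteq> convex_cone hull (insert x \<rho>) \<longleftrightarrow> z \<subseteq> \<rho>"
proof
  have cone: "convex_cone s" if "s \<in> \<Sigma>" for s
    using fan that by (simp add: polyhedral_fan_def pointed_polyhedral_cone_def)
  show "z \<subseteq> convex_cone hull (insert x \<rho>)" if "z \<subseteq> \<rho>"
    using that hull_subset[of "insert x \<rho>" convex_cone] by blast
  assume z: "z \<subseteq> convex_cone hull (insert x \<rho>)"
  show "z \<subseteq> \<rho>"
  proof
    fix v assume "v \<in> z"
    then obtain r t where rt: "r \<in> \<rho>" "0 \<le> t" "v = r + t *\<^sub>R x"
      using z convex_cone_hull_insert_subset[OF cone[OF mem(2)]] by blast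
    \<comment> \<open>Both summands of \<open>v\<close> lie in \<open>\<sigma>\<close>, so the face
      \<open>z \<inter> \<sigma>\<close> of \<open>\<sigma>\<close>, which contains
      \<open>v\<close>, must contain each of them.\<close>
    have "r \<in> \<sigma>" "t *\<^sub>R x \<in> \<sigma>"
      using rt assms cone[OF mem(1)] by (auto intro: convex_cone_scaleR)
    then have "v \<in> z \<inter> \<sigma>"
      using rt \<open>v \<in> z\<close> cone[OF mem(1)] by (auto intro: convex_cone_add)
    moreover have "z \<inter> \<sigma> face_of \<sigma>"
      using fan mem by (auto simp: polyhedral_fan_def)
    ultimately have "t *\<^sub>R x \<in> z \<inter> \<sigma>"
      using convex_cone_face_of_summand cone polyhedral_fan_Int[OF fan] mem
        \<open>r \<in> \<sigma>\<close> \<open>t *\<^sub>R x \<in> \<sigma>\<close> rt(3) by metis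
    moreover have "t = 0"
    proof (rule ccontr)
      assume "t \<noteq> 0"
      then have "inverse t *\<^sub>R t *\<^sub>R x \<in> z"
        using convex_cone_scaleR[OF cone[OF mem(3)], of "inverse t"] \<open>t *\<^sub>R x \<in> z \<inter> \<sigma>\<close> rt(2)
        by (simp del: scaleR_scaleR)
      then show False
        using \<open>t \<noteq> 0\<close> \<open>x \<notin> z\<close> by simp
    qed
    ultimately show "v \<in> \<rho>"
      using rt by simp
  qed
qed

section \<open>The isomorphism\<close>

fun blowup_cone :: "'a::real_vector \<Rightarrow> 'a set blowup_elem \<Rightarrow> 'a set"
  where
    "blowup_cone x (Elem \<rho>) = \<rho>"
  | "blowup_cone x (Symb _ \<rho>) = convex_cone hull (insert x \<rho>)"

theorem proposition4p9:
  fixes \<Sigma> :: "'a::euclidean_space set set" and \<tau> :: "'a set" and x :: 'a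
  assumes "polyhedral_fan \<Sigma>"
    and "\<tau> \<in> \<Sigma>" and "\<tau> \<noteq> {0}"
    and "x \<in> rel_interior \<tau>"
  shows "order_isomorphic (face_poset (stellar_subdivision \<Sigma> \<tau> x)) (blowup \<tau> (face_poset \<Sigma>))"
proof -
  let ?B = "blowup \<tau> (face_poset \<Sigma>)" and ?S = "face_poset (stellar_subdivision \<Sigma> \<tau> x)"
  let ?C = "\<lambda>\<rho>. convex_cone hull (insert x \<rho>)"
  \<comment> \<open>\<open>A\<close> consists of the cones that survive, \<open>J\<close> of those
    that are joined to \<open>x\<close>; together they index both the carrier of the blowup and the
    subdivision.\<close>
  define A where "A = \<Sigma> - fan_star \<tau> \<Sigma>"
  define J where "J = {\<rho> \<in> A. \<exists>\<sigma>\<in>fan_star \<tau> \<Sigma>. \<rho> \<subseteq> \<sigma>}"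
  have JA: "J \<subseteq> A"
    by (auto simp: J_def)
  have B: "carrier ?B = Elem ` A \<union> Symb \<tau> ` J"
  proof -
    have A: "y \<in> carrier (face_poset \<Sigma>) \<and> \<not> \<tau> \<sqsubseteq>\<^bsub>face_poset \<Sigma>\<^esub> y \<longleftrightarrow> y \<in> A" for y
      by (auto simp: A_def fan_star_def face_poset_def)
    have J: "y \<in> A \<and> (\<exists>j. least (face_poset \<Sigma>) j (Upper (face_poset \<Sigma>) {y, \<tau>})) \<longleftrightarrow> y \<in> J" for y
      using polyhedral_fan_join_exists_iff[OF assms(1) _ assms(2), of y] by (auto simp: A_def J_def)
    have "carrier ?B = {Elem y |y. y \<in> A} \<union> {Symb \<tau> y |y. y \<in> J}"
      by (simp add: blowup_def A J flip: conj_assoc)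
    then show ?thesis
      by blast
  qed
  have S: "carrier ?S = A \<union> ?C ` J"
    by (auto simp: face_poset_def stellar_subdivision_def A_def J_def)
  have notin: "x \<notin> z" if "z \<in> A" for z
    using polyhedral_fan_mem_rel_interior_iff[OF assms(1,2) _ assms(4)] that
    by (auto simp: A_def fan_star_def)
  have x: "x \<in> ?C \<rho>" for \<rho>
    by (simp add: hull_inc)
  have sub: "z \<subseteq> ?C y \<longleftrightarrow> z \<subseteq> y" if zy: "z \<in> A" "y \<in> J" for z y
  proof -
    obtain \<sigma> where "\<sigma> \<in> \<Sigma>" "\<tau> \<subseteq> \<sigma>" "y \<subseteq> \<sigma>"
      using zy by (auto simp: J_def fan_star_def)
    then show ?thesis
      using zy notin subset_convex_cone_hull_insert_iff[OF assms(1), of \<sigma> y z x] assms(4)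
        rel_interior_subset[of \<tau>]
      by (auto simp: A_def J_def)
  qed
  \<comment> \<open>Since \<open>z\<close> lies in its own cone over \<open>x\<close>, the forward
    direction reduces to \<open>sub\<close>; the converse is monotonicity of the hull.\<close>
  have CC: "?C z \<subseteq> ?C y \<longleftrightarrow> z \<subseteq> y" if "z \<in> J" "y \<in> J" for z y
  proof
    assume "?C z \<subseteq> ?C y"
    then have "z \<subseteq> ?C y"
      using hull_subset[of "insert x z" convex_cone] by blast
    then show "z \<subseteq> y"
      using sub that JA by blast
  qed (intro hull_mono insert_mono)
  have CA: "\<not> ?C z \<subseteq> y" if "y \<in> A" for z y
    using x notin[OF that] by blast
  have emb: "order_emb ?B ?S (blowup_cone x)"
    unfolding order_emb_def
  proof (intro conjI ballI)
    show "weak_partial_order ?B" "weak_partial_order ?S"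
      using blowup_face_poset_partial_order face_poset_partial_order
      by (auto simp: partial_order_def)
  next
    fix u v assume uv: "u \<in> carrier ?B" "v \<in> carrier ?B"
    have le: "a \<sqsubseteq>\<^bsub>?S\<^esub> b \<longleftrightarrow> a \<subseteq> b" for a b
      by (simp add: face_poset_def)
    show "blowup_cone x u \<sqsubseteq>\<^bsub>?S\<^esub> blowup_cone x v \<longleftrightarrow> u \<sqsubseteq>\<^bsub>?B\<^esub> v"
      unfolding blowup_face_poset_le[OF uv] le
      \<comment> \<open>Two old cones compare as in the fan, an old with a new one by
        \<open>sub\<close>, two new ones by \<open>CC\<close>; \<open>CA\<close> rules out a new
        cone inside an old one, which misses \<open>x\<close>.\<close>
      using uv unfolding B by (elim UnE imageE) (simp_all add: sub CC CA)
  qed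
  \<comment> \<open>That distinct symbols span distinct cones, and that no new cone equals an old
    one, follows from order reflection and antisymmetry.\<close>
  moreover have "inj_on (blowup_cone x) (carrier ?B)"
    by (intro order_emb_inj_on[OF emb] blowup_face_poset_partial_order face_poset_partial_order)
  moreover have "blowup_cone x ` carrier ?B = carrier ?S"
    by (simp add: B S image_Un image_image)
  ultimately have "order_isomorphic ?B ?S"
    unfolding order_isomorphic_def bij_betw_def by blast
  then show ?thesis
    by (rule order_isomorphic_sym)
qed

end
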